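(* There is an absolute constant $C>0$ such that the following holds. Let $n,N\in\mathbb N$, $m=\frac{n(n+1)}2$, let $\widehat{\mathsf Q}_1,\dots,\widehat{\mathsf Q}_N$ be i.i.d. random matrices in $\mathcal S^n$ with law $\mathbb P_{\rm true}$ such that $\widehat{\boldsymbol\xi}_i=\operatorname{svec}(\widehat{\mathsf Q}_i)\in\mathbb R^m$ are sub-exponential random vectors, and let $\beta\in(0,1)$, $\mathbf y\in\mathbb S^{n-1}$. (1) With $K:=\max_i\|\widehat{\boldsymbol\xi}_i\|_{\psi_1}$, $$\mathbb P_{\rm true}^N\left[\mathbf y^\top\big(\mathbb E_{\widehat{\mathbb P}_N}[\widetilde{\mathsf Q}]-\mathbb E_{\mathbb P_{\rm true}}[\widetilde{\mathsf Q}]\big)\mathbf y\le CK\left(\sqrt{\frac{m+\log(2/\beta)}N}+\frac{m+\log(2/\beta)}N\right)\right]\ge1-\beta.$$ (2) If moreover there is $R>0$ with $\big\|\,\|\widehat{\boldsymbol\xi}_i\|_2\big\|_{\psi_1}\le R$ for all $i\in\{1,\dots,N\}$, then $$\mathbb P_{\rm true}^N\left[\mathbf y^\top\big(\mathbb E_{\widehat{\mathbb P}_N}[\widetilde{\mathsf Q}]-\mathbb E_{\mathbb P_{\rm true}}[\widetilde{\mathsf Q}]\big)\mathbf y\le2\sqrt2\,R\sqrt{\frac{2\log(2/\beta)}N}+\frac{R\log(2/\beta)}N\right]\ge1-\beta.$$ (3) If the $\widehat{\boldsymbol\xi}_i$ are i.i.d. sub-Gaussian random vectors, then with $K:=\max_i\|\widehat{\boldsymbol\xi}_i\|_{\psi_2}$,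 $$\mathbb P_{\rm true}^N\left[\mathbf y^\top\big(\mathbb E_{\widehat{\mathbb P}_N}[\widetilde{\mathsf Q}]-\mathbb E_{\mathbb P_{\rm true}}[\widetilde{\mathsf Q}]\big)\mathbf y\le CK\left(\sqrt{\frac mN}+\sqrt{\frac{\log(2/\beta)}N}\right)\right]\ge1-\beta.$$
   Context: $\mathcal S^n$: real symmetric $n\times n$ matrices. For $\mathsf A=(a_{ij})\in\mathcal S^n$, $\operatorname{svec}(\mathsf A)=(a_{11},\dots,a_{nn},\sqrt2a_{12},\sqrt2a_{13},\dots,\sqrt2a_{n-1,n})^\top\in\mathbb R^m$. For a real random variable $\tilde\xi$ and $q\in\{1,2\}$, $\|\tilde\xi\|_{\psi_q}=\inf\{t>0:\mathbb E[\exp(|\tilde\xi|^q/t^q)]\le2\}$; for a random vector $\tilde{\boldsymbol\xi}\in\mathbb R^m$, $\|\tilde{\boldsymbol\xi}\|_{\psi_q}=\sup_{\mathbf u\in\mathbb S^{m-1}}\|\mathbf u^\top\tilde{\boldsymbol\xi}\|_{\psi_q}$. A random variable or vector is sub-exponential if its $\psi_1$-norm is finite, and sub-Gaussian if its $\psi_2$-norm is finite. $\mathbb S^{k-1}$ is the Euclidean unit sphere in $\mathbb R^k$. $\mathbb P_{\rm true}^N$ is the joint law of the sample, and $\mathbb E_{\widehat{\mathbb P}_N}[\widetilde{\mathsf Q}]=\frac1N\sum_{i=1}^N\widehat{\mathsf Q}_i$. *)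

theory Defs
  imports "HOL-Probability.Probability" "Jordan_Normal_Form.Matrix"
begin

unbundle no inner_syntax and no vec_syntax
hide_type (open) Finite_Cartesian_Product.vec
hide_const (open) Finite_Cartesian_Product.vec Finite_Cartesian_Product.mat

definition sym_mats :: "nat \<Rightarrow> real mat set" where
  "sym_mats n = {A \<in> carrier_mat n n. transpose_mat A = A}"

(* The Borel sigma-algebra of the symmetric matrices, a finite-dimensional real space: it is
   generated by the coordinate maps, i.e. the matrix entries. *)
definition sym_borel :: "nat \<Rightarrow> real mat measure" where
  "sym_borel n =
     sigma (sym_mats n)
       {{A \<in> sym_mats n. A $$ (i, j) \<in> B} | i j B. i < n \<and> j < n \<and> B \<in> sets borel}"

(* The diagonal first, then the strict upper triangle row by row, scaled by sqrt 2. *)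
definition svec :: "real mat \<Rightarrow> real vec" where
  "svec A = (let n = dim_row A in
     vec_of_list ([A $$ (i, i). i \<leftarrow> [0..<n]] @
                  [sqrt 2 * A $$ (i, j). i \<leftarrow> [0..<n], j \<leftarrow> [Suc i..<n]]))"

lemma dim_svec:
  assumes "A \<in> carrier_mat n n"
  shows "dim_vec (svec A) = n * (n + 1) div 2"
proof -
  have "length [sqrt 2 * A $$ (i, j). i \<leftarrow> [0..<k], j \<leftarrow> [Suc i..<n]] =
      (\<Sum>i<k. n - Suc i)" for k
    by (induction k) auto
  moreover have "(\<Sum>i<n. n - Suc i) = \<Sum>{..<n}"
    using sum.nat_diff_reindex[of "\<lambda>i. i" n] by simp
  moreover have "2 * (n + \<Sum>{..<n}) = n * (n + 1)"
    by (induction n) auto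
  ultimately show ?thesis
    using assms by (simp add: svec_def Let_def)
qed

definition vec_norm :: "real vec \<Rightarrow> real" where
  "vec_norm v = sqrt (v \<bullet> v)"

definition unit_sphere :: "nat \<Rightarrow> real vec set" where
  "unit_sphere k = {u \<in> carrier_vec k. vec_norm u = 1}"

(* Valued in ennreal, with a nonnegative integral as expectation, so that the norm is infinite
   exactly when no t > 0 is admissible. *)
definition psi_norm :: "nat \<Rightarrow> 'a measure \<Rightarrow> ('a \<Rightarrow> real) \<Rightarrow> ennreal" where
  "psi_norm q M X =
     Inf {ennreal t | t. t > 0 \<and> (\<integral>\<^sup>+ \<omega>. ennreal (exp (\<bar>X \<omega>\<bar> ^ q / t ^ q)) \<partial>M) \<le> 2}"

definition psi_norm_vec :: "nat \<Rightarrow> nat \<Rightarrow> 'a measure \<Rightarrow> ('a \<Rightarrow> real vec) \<Rightarrow> ennreal" where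
  "psi_norm_vec q m M X = (SUP u\<in>unit_sphere m. psi_norm q M (\<lambda>\<omega>. u \<bullet> X \<omega>))"

definition sub_exponential_vec :: "nat \<Rightarrow> 'a measure \<Rightarrow> ('a \<Rightarrow> real vec) \<Rightarrow> bool" where
  "sub_exponential_vec m M X \<longleftrightarrow> psi_norm_vec 1 m M X < \<infinity>"

definition sub_gaussian_vec :: "nat \<Rightarrow> 'a measure \<Rightarrow> ('a \<Rightarrow> real vec) \<Rightarrow> bool" where
  "sub_gaussian_vec m M X \<longleftrightarrow> psi_norm_vec 2 m M X < \<infinity>"

(* The joint law of N i.i.d. samples from P. The samples are the coordinates, numbered from 0. *)
definition sample_law :: "nat \<Rightarrow> real mat measure \<Rightarrow> (nat \<Rightarrow> real mat) measure" where
  "sample_law N P = PiM {..<N} (\<lambda>_. P)"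

definition true_mean :: "nat \<Rightarrow> real mat measure \<Rightarrow> real mat" where
  "true_mean n P = mat n n (\<lambda>ij. \<integral>A. A $$ ij \<partial>P)"

definition empirical_mean :: "nat \<Rightarrow> nat \<Rightarrow> (nat \<Rightarrow> real mat) \<Rightarrow> real mat" where
  "empirical_mean n N Q = mat n n (\<lambda>ij. (\<Sum>i<N. Q i $$ ij) / real N)"

end

theory Submission
  imports Defs
begin

text \<open>
  The deviation of the sample mean is needed in a single direction \<open>y\<close> only. The form
  \<open>A \<mapsto> y \<bullet> (A *\<^sub>v y)\<close> is linear in \<open>A\<close>: on symmetric matrices it is the
  inner product of \<open>svec A\<close> with the vector \<open>svec (y y\<^sup>T)\<close>, which again has norm \<open>1\<close>
  (\<open>svec_inner\<close>, \<open>svec_outer_square_unit\<close>). The random variable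
  \<open>X = y \<bullet> (A *\<^sub>v y)\<close> thus inherits, as a one-dimensional marginal, the \<open>\<psi>\<^sub>1\<close>- or
  \<open>\<psi>\<^sub>2\<close>-norm bound of the vector, and by Cauchy-Schwarz that of its Euclidean norm
  (\<open>psi_norm_quad_form_le\<close>). All three claims are scalar concentration inequalities
  for the sample mean of \<open>X\<close>.

  The scalar inequalities come from the exponential Markov inequality
  (\<open>sample_mean_chernoff\<close>) and two bounds for the centred moment generating function. If
  \<open>E (exp \<bar>X\<bar>) \<le> B\<close> it is at most \<open>exp ((B - 1) * l\<^sup>2)\<close> for \<open>0 \<le> l \<le> 1\<close>, since
  replacing \<open>x\<close> by \<open>l * x\<close> shrinks all terms of degree at least two of the exponential series
  by a factor \<open>l\<^sup>2\<close> (\<open>centered_mgf_le\<close>). If \<open>E (exp (X\<^sup>2)) \<le> 2\<close> a bound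
  \<open>exp (3 * l\<^sup>2)\<close> holds for every \<open>l \<ge> 0\<close> (\<open>centered_mgf_le_subgaussian\<close>). With
  \<open>s = ln (2 / \<beta>) / N\<close> the resulting thresholds are \<open>K * (2 * sqrt s + s)\<close> and
  \<open>K * (4 * sqrt s)\<close>, each exceeded with probability at most \<open>exp (- N * s) = \<beta> / 2\<close>. Both are
  small enough for the claims with \<open>C = 4\<close>, and the first one also for the explicit constants in
  terms of \<open>R\<close>.

  The infimum \<open>K\<close> that defines a \<open>\<psi>\<close>-norm may be \<open>0\<close>, and it is not known in advance
  to be attained. The inequalities are therefore proved for every scale \<open>t > K\<close>, and continuity of the
  measure from above carries them to \<open>t = K\<close> (\<open>prob_le_right_limit\<close>).
\<close>

section \<open>Centred moment generating functions\<close>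

text \<open>
  Termwise comparison of the exponential series from degree two on: for \<open>0 \<le> l \<le> 1\<close> and
  \<open>k \<ge> 2\<close> one has \<open>(l * x) ^ k \<le> l\<^sup>2 * \<bar>x\<bar> ^ k\<close>.
\<close>

lemma exp_remainder_scale:
  fixes l x :: real
  assumes "0 \<le> l" "l \<le> 1"
  shows "exp (l * x) - 1 - l * x \<le> l\<^sup>2 * (exp \<bar>x\<bar> - 1 - \<bar>x\<bar>)"
proof -
  have series: "(\<lambda>k. inverse (fact (k + 2)) * z ^ (k + 2)) sums (exp z - 1 - z)" for z :: real
  proof -
    have "summable (\<lambda>k. inverse (fact (k + 2)) * z ^ (k + 2))"
      using summable_ignore_initial_segment[OF summable_exp[of z], of 2] by simp
    then show ?thesis
      using exp_first_two_terms[of z] by (simp add: sums_iff)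
  qed
  have "inverse (fact (k + 2)) * (l * x) ^ (k + 2)
      \<le> l\<^sup>2 * (inverse (fact (k + 2)) * \<bar>x\<bar> ^ (k + 2))" for k
  proof -
    have "(l * x) ^ (k + 2) \<le> l ^ (k + 2) * \<bar>x\<bar> ^ (k + 2)"
      using abs_ge_self[of "(l * x) ^ (k + 2)"] assms
      by (simp add: power_abs abs_mult power_mult_distrib del: power_Suc add_2_eq_Suc')
    also have "\<dots> \<le> l\<^sup>2 * \<bar>x\<bar> ^ (k + 2)"
      using assms by (intro mult_right_mono power_decreasing) auto
    finally show ?thesis
      by (subst mult.left_commute) (intro mult_left_mono, auto)
  qed
  then show ?thesis
    by (rule sums_le[OF _ series sums_mult[OF series]])
qed

lemma (in prob_space) nn_integral_exp_leD:
  assumes "X \<in> borel_measurable M" "(\<integral>\<^sup>+\<omega>. ennreal (exp (X \<omega>)) \<partial>M) \<le> ennreal B" "0 \<le> B"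
  shows "integrable M (\<lambda>\<omega>. exp (X \<omega>))" "expectation (\<lambda>\<omega>. exp (X \<omega>)) \<le> B"
proof -
  show 1: "integrable M (\<lambda>\<omega>. exp (X \<omega>))"
    using assms by (intro integrableI_nonneg) (auto simp: order.strict_trans1)
  show "expectation (\<lambda>\<omega>. exp (X \<omega>)) \<le> B"
    using assms by (subst (asm) nn_integral_eq_integral[OF 1]) auto
qed

lemma (in prob_space) integrable_of_exp_abs:
  assumes [measurable]: "X \<in> borel_measurable M"
    and "(\<integral>\<^sup>+\<omega>. ennreal (exp \<bar>X \<omega>\<bar>) \<partial>M) \<le> ennreal B" "0 \<le> B"
  shows "integrable M X"
proof (rule Bochner_Integration.integrable_bound)
  show "integrable M (\<lambda>\<omega>. exp \<bar>X \<omega>\<bar>)"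
    using assms by (intro nn_integral_exp_leD) auto
  show "AE \<omega> in M. norm (X \<omega>) \<le> norm (exp \<bar>X \<omega>\<bar>)"
    using exp_ge_add_one_self by (intro AE_I2) (simp add: order_trans[OF _ exp_ge_add_one_self])
qed simp

text \<open>
  Integrating \<open>exp_remainder_scale\<close> gives
  \<open>E (exp (l * X)) \<le> 1 + l * E X + (B - 1) * l\<^sup>2\<close>. Applying \<open>1 + z \<le> exp z\<close> to the whole
  right-hand side produces the factor \<open>exp (l * E X)\<close>, which the centring cancels.
\<close>

lemma (in prob_space) centered_mgf_le:
  assumes [measurable]: "X \<in> borel_measurable M"
    and B: "(\<integral>\<^sup>+\<omega>. ennreal (exp \<bar>X \<omega>\<bar>) \<partial>M) \<le> ennreal B" "0 \<le> B"
    and l: "0 \<le> l" "l \<le> 1"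
  shows "(\<integral>\<^sup>+\<omega>. ennreal (exp (l * (X \<omega> - expectation X))) \<partial>M) \<le> ennreal (exp ((B - 1) * l\<^sup>2))"
proof -
  note E = nn_integral_exp_leD[OF _ B]
  have X: "integrable M X"
    by (rule integrable_of_exp_abs[OF _ B]) simp
  have le: "exp (l * X \<omega>) \<le> 1 + l * X \<omega> + l\<^sup>2 * (exp \<bar>X \<omega>\<bar> - 1)" for \<omega>
    using exp_remainder_scale[OF l, of "X \<omega>"] by (simp add: algebra_simps)
      (smt (verit) abs_ge_zero mult_nonneg_nonneg zero_le_power2)
  have "(\<integral>\<^sup>+\<omega>. ennreal (exp (l * X \<omega>)) \<partial>M)
      \<le> (\<integral>\<^sup>+\<omega>. ennreal (1 + l * X \<omega> + l\<^sup>2 * (exp \<bar>X \<omega>\<bar> - 1)) \<partial>M)"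
    by (intro nn_integral_mono ennreal_leI le)
  also have "\<dots> = ennreal (expectation (\<lambda>\<omega>. 1 + l * X \<omega> + l\<^sup>2 * (exp \<bar>X \<omega>\<bar> - 1)))"
    using X E(1) by (intro nn_integral_eq_integral AE_I2 order_trans[OF _ le]) auto
  also have "expectation (\<lambda>\<omega>. 1 + l * X \<omega> + l\<^sup>2 * (exp \<bar>X \<omega>\<bar> - 1))
      = 1 + l * expectation X + l\<^sup>2 * (expectation (\<lambda>\<omega>. exp \<bar>X \<omega>\<bar>) - 1)"
    using X E(1) by (simp add: prob_space)
  also have "\<dots> \<le> 1 + (l * expectation X + l\<^sup>2 * (B - 1))"
    using E(2) by (simp add: mult_left_mono)
  also have "\<dots> \<le> exp (l * expectation X + l\<^sup>2 * (B - 1))"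
    by (rule exp_ge_add_one_self)
  finally have mgf: "(\<integral>\<^sup>+\<omega>. ennreal (exp (l * X \<omega>)) \<partial>M)
      \<le> ennreal (exp (l * expectation X + l\<^sup>2 * (B - 1)))"
    by (simp add: ennreal_leI)
  have "(\<integral>\<^sup>+\<omega>. ennreal (exp (l * (X \<omega> - expectation X))) \<partial>M)
      = (\<integral>\<^sup>+\<omega>. ennreal (exp (- l * expectation X)) * ennreal (exp (l * X \<omega>)) \<partial>M)"
    by (intro nn_integral_cong) (simp add: ennreal_mult[symmetric] exp_add[symmetric] algebra_simps)
  also have "\<dots> = ennreal (exp (- l * expectation X)) * (\<integral>\<^sup>+\<omega>. ennreal (exp (l * X \<omega>)) \<partial>M)"
    by (rule nn_integral_cmult) simp
  also have "\<dots> \<le> ennreal (exp (- l * expectation X))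
      * ennreal (exp (l * expectation X + l\<^sup>2 * (B - 1)))"
    by (intro mult_left_mono mgf) simp
  finally show ?thesis
    by (simp add: ennreal_mult[symmetric] exp_add[symmetric] mult.commute)
qed

text \<open>
  For \<open>l \<le> 1\<close> this is the sub-exponential bound, because \<open>\<bar>x\<bar> \<le> 1/4 + x\<^sup>2\<close>
  bounds \<open>E (exp \<bar>X\<bar>)\<close> by \<open>4\<close>. For \<open>l > 1\<close> no cancellation is needed: the
  inequality \<open>l * \<bar>x\<bar> \<le> l\<^sup>2 / 4 + x\<^sup>2\<close> bounds the uncentred function, and the
  centring and the factor \<open>2\<close> cost at most \<open>exp l\<close> and \<open>exp 1\<close>, which are at most
  \<open>exp (l\<^sup>2)\<close>.
\<close>

lemma (in prob_space) centered_mgf_le_subgaussian: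
  assumes [measurable]: "X \<in> borel_measurable M"
    and B: "(\<integral>\<^sup>+\<omega>. ennreal (exp ((X \<omega>)\<^sup>2)) \<partial>M) \<le> ennreal 2"
    and l: "0 \<le> l"
  shows "(\<integral>\<^sup>+\<omega>. ennreal (exp (l * (X \<omega> - expectation X))) \<partial>M) \<le> ennreal (exp (3 * l\<^sup>2))"
proof -
  have sq: "x \<le> a\<^sup>2 / 4 + y\<^sup>2" if "x = a * \<bar>y\<bar>" for x a y :: real
    using zero_le_power2[of "a / 2 - \<bar>y\<bar>"] that by (simp add: power2_diff power_divide)
  have scaled: "(\<integral>\<^sup>+\<omega>. ennreal (exp (a * \<bar>X \<omega>\<bar>)) \<partial>M) \<le> ennreal (2 * exp (a\<^sup>2 / 4))" for a
  proof -
    have "(\<integral>\<^sup>+\<omega>. ennreal (exp (a * \<bar>X \<omega>\<bar>)) \<partial>M)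
        \<le> (\<integral>\<^sup>+\<omega>. ennreal (exp (a\<^sup>2 / 4)) * ennreal (exp ((X \<omega>)\<^sup>2)) \<partial>M)"
      using sq by (intro nn_integral_mono) (simp add: ennreal_mult[symmetric] exp_add[symmetric])
    also have "\<dots> = ennreal (exp (a\<^sup>2 / 4)) * (\<integral>\<^sup>+\<omega>. ennreal (exp ((X \<omega>)\<^sup>2)) \<partial>M)"
      by (rule nn_integral_cmult) simp
    also have "\<dots> \<le> ennreal (exp (a\<^sup>2 / 4)) * ennreal 2"
      by (intro mult_left_mono B) simp
    finally show ?thesis
      by (subst mult.commute) (simp add: ennreal_mult)
  qed
  have quarter: "2 * exp (1 / 4) \<le> (4 :: real)"
    using exp_half_le2 order_trans[of "exp (1/4)" "exp (1/2 :: real)" 2] by simp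
  have B1: "(\<integral>\<^sup>+\<omega>. ennreal (exp \<bar>X \<omega>\<bar>) \<partial>M) \<le> ennreal 4"
    using order_trans[OF scaled[of 1], of "ennreal 4"] ennreal_leI[OF quarter] by simp
  show ?thesis
  proof (cases "l \<le> 1")
    case True
    then show ?thesis
      using centered_mgf_le[OF _ B1 _ l] by simp
  next
    case False
    have X: "integrable M X"
      by (rule integrable_of_exp_abs[OF _ B1]) auto
    \<comment> \<open>The mean is at least \<open>-1\<close>, since \<open>-2 * x \<le> 1 + x\<^sup>2 \<le> exp (x\<^sup>2)\<close>.\<close>
    have "- expectation X = expectation (\<lambda>\<omega>. - X \<omega>)"
      by simp
    also have "\<dots> \<le> expectation (\<lambda>\<omega>. exp ((X \<omega>)\<^sup>2) / 2)"
    proof (rule integral_mono)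
      show "integrable M (\<lambda>\<omega>. exp ((X \<omega>)\<^sup>2) / 2)"
        using nn_integral_exp_leD[OF _ B] by simp
      show "- X \<omega> \<le> exp ((X \<omega>)\<^sup>2) / 2" for \<omega>
      proof -
        have "0 \<le> (X \<omega>)\<^sup>2 + 1 + 2 * X \<omega>"
          using zero_le_power2[of "X \<omega> + 1"] by (simp add: power2_sum)
        then show ?thesis
          using exp_ge_add_one_self[of "(X \<omega>)\<^sup>2"] by linarith
      qed
    qed (use X in simp)
    also have "\<dots> \<le> 1"
      using nn_integral_exp_leD[OF _ B] by simp
    finally have mean: "- (l * expectation X) \<le> l"
      using mult_left_mono[of "- expectation X" 1 l] l by simp
    have "(\<integral>\<^sup>+\<omega>. ennreal (exp (l * (X \<omega> - expectation X))) \<partial>M)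
      \<le> (\<integral>\<^sup>+\<omega>. ennreal (exp l) * ennreal (exp (l * \<bar>X \<omega>\<bar>)) \<partial>M)"
    proof (intro nn_integral_mono)
      fix \<omega>
      have "l * (X \<omega> - expectation X) \<le> l + l * \<bar>X \<omega>\<bar>"
        using mean mult_left_mono[OF abs_ge_self[of "X \<omega>"] l] by (simp add: right_diff_distrib)
      then show "ennreal (exp (l * (X \<omega> - expectation X))) \<le> ennreal (exp l) * ennreal (exp (l * \<bar>X \<omega>\<bar>))"
        by (simp add: ennreal_mult[symmetric] exp_add[symmetric])
    qed
    also have "\<dots> = ennreal (exp l) * (\<integral>\<^sup>+\<omega>. ennreal (exp (l * \<bar>X \<omega>\<bar>)) \<partial>M)"
      by (rule nn_integral_cmult) simp
    also have "\<dots> \<le> ennreal (exp l) * ennreal (2 * exp (l\<^sup>2 / 4))"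
      by (intro mult_left_mono scaled) simp
    also have "\<dots> = ennreal (2 * exp (l + l\<^sup>2 / 4))"
      by (simp add: ennreal_mult[symmetric] exp_add)
    also have "\<dots> \<le> ennreal (exp 1 * exp (l + l\<^sup>2 / 4))"
      using exp_ge_add_one_self[of 1] by (intro ennreal_leI mult_right_mono) auto
    also have "\<dots> \<le> ennreal (exp (3 * l\<^sup>2))"
    proof -
      have "1 \<le> l\<^sup>2" "l \<le> l\<^sup>2"
        using False by (simp_all add: power2_eq_square) (simp add: mult_ge1_I)
      then show ?thesis
        by (simp add: exp_add[symmetric])
    qed
    finally show ?thesis .
  qed
qed

section \<open>Exponential Markov inequality and limits of scales\<close>

text \<open>
  By independence the moment generating function of the centred sum is the \<open>N\<close>-th power of that of
  one term, so \<open>exp (N * b)\<close> competes with the factor \<open>exp (- N * l * e)\<close> of the Markov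
  inequality at the threshold \<open>e\<close>.
\<close>

lemma (in prob_space) sample_mean_chernoff:
  fixes N :: nat and X :: "'a \<Rightarrow> real"
  assumes [measurable]: "X \<in> borel_measurable M"
    and N: "0 < N" and l: "0 < l"
    and mgf: "(\<integral>\<^sup>+\<omega>. ennreal (exp (l * (X \<omega> - expectation X))) \<partial>M) \<le> ennreal (exp b)"
    and b: "b + s \<le> l * e"
  shows "1 - exp (- (real N * s))
      \<le> \<P>(\<omega> in Pi\<^sub>M {..<N} (\<lambda>_. M). (\<Sum>i<N. X (\<omega> i)) / real N - expectation X \<le> e)"
proof -
  let ?M = "Pi\<^sub>M {..<N} (\<lambda>_. M)"
  let ?S = "\<lambda>\<omega>. \<Sum>i<N. X (\<omega> i) - expectation X"
  interpret PM: prob_space ?M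
    by (intro prob_space_PiM prob_space_axioms)
  interpret pf: product_sigma_finite "\<lambda>_ :: nat. M"
    by unfold_locales
  have S[measurable]: "?S \<in> borel_measurable ?M"
    by measurable
  have "emeasure ?M {\<omega> \<in> space ?M. ?S \<omega> \<ge> real N * e}
      \<le> ennreal (exp (- l * (real N * e)))
        * (\<integral>\<^sup>+\<omega>. ennreal (exp (l * ?S \<omega>)) * indicator (space ?M) \<omega> \<partial>?M)"
    using l by (intro Chernoff_ineq_nn_integral_ge) auto
  also have "(\<integral>\<^sup>+\<omega>. ennreal (exp (l * ?S \<omega>)) * indicator (space ?M) \<omega> \<partial>?M)
      = (\<integral>\<^sup>+\<omega>. (\<Prod>i<N. ennreal (exp (l * (X (\<omega> i) - expectation X)))) \<partial>?M)"
    by (intro nn_integral_cong) (simp add: sum_distrib_left exp_sum prod_ennreal)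
  also have "\<dots> = (\<Prod>i<N. \<integral>\<^sup>+\<omega>. ennreal (exp (l * (X \<omega> - expectation X))) \<partial>M)"
    by (rule pf.product_nn_integral_prod) simp_all
  also have "\<dots> \<le> (\<Prod>i<N. ennreal (exp b))"
    by (intro prod_mono_ennreal mgf)
  also have "\<dots> = ennreal (exp (real N * b))"
    by (simp add: ennreal_power exp_of_nat_mult)
  also have "ennreal (exp (- l * (real N * e))) * \<dots> \<le> ennreal (exp (- (real N * s)))"
  proof -
    have "real N * (b + s) \<le> real N * (l * e)"
      by (intro mult_left_mono b) simp
    then show ?thesis
      by (simp add: ennreal_mult[symmetric] exp_add[symmetric] algebra_simps)
  qed
  finally have "PM.prob {\<omega> \<in> space ?M. ?S \<omega> \<ge> real N * e} \<le> exp (- (real N * s))"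
    by (simp add: PM.emeasure_eq_measure mult_left_mono)
  then have "1 - exp (- (real N * s)) \<le> 1 - PM.prob {\<omega> \<in> space ?M. ?S \<omega> \<ge> real N * e}"
    by simp
  also have "\<dots> = PM.prob (space ?M - {\<omega> \<in> space ?M. ?S \<omega> \<ge> real N * e})"
    by (subst PM.prob_compl) auto
  also have "\<dots> \<le> \<P>(\<omega> in ?M. (\<Sum>i<N. X (\<omega> i)) / real N - expectation X \<le> e)"
    using N by (intro PM.finite_measure_mono) (auto simp: sum_subtractf field_simps)
  finally show ?thesis .
qed

text \<open>
  The events \<open>Z \<le> t * c\<close> decrease to \<open>Z \<le> K * c\<close> as \<open>t\<close> decreases to \<open>K\<close>. This
  handles scales \<open>K\<close> at which the defining bound of a \<open>\<psi>\<close>-norm is only known in the limit,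
  and in particular \<open>K = 0\<close>, where rescaling by \<open>1 / K\<close> is impossible.
\<close>

lemma (in prob_space) prob_le_right_limit:
  fixes Z :: "'a \<Rightarrow> real"
  assumes [measurable]: "Z \<in> borel_measurable M" and c: "0 < c"
    and p: "\<And>t. K < t \<Longrightarrow> p \<le> \<P>(\<omega> in M. Z \<omega> \<le> t * c)"
  shows "p \<le> \<P>(\<omega> in M. Z \<omega> \<le> K * c)"
proof -
  let ?A = "\<lambda>k :: nat. {\<omega> \<in> space M. Z \<omega> \<le> (K + inverse (real (Suc k))) * c}"
  have lim: "(\<lambda>k. (K + inverse (real (Suc k))) * c) \<longlonglongrightarrow> (K + 0) * c"
    by (intro tendsto_intros LIMSEQ_inverse_real_of_nat)
  have "(\<lambda>k. prob (?A k)) \<longlonglongrightarrow> prob (\<Inter>k. ?A k)"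
  proof (rule finite_Lim_measure_decseq)
    show "decseq ?A"
    proof (intro decseq_SucI subsetI)
      fix k \<omega> assume "\<omega> \<in> ?A (Suc k)"
      moreover have "(K + inverse (real (Suc (Suc k)))) * c \<le> (K + inverse (real (Suc k))) * c"
        using c by (intro mult_right_mono add_left_mono le_imp_inverse_le) auto
      ultimately show "\<omega> \<in> ?A k"
        by auto
    qed
  qed auto
  moreover have "(\<Inter>k. ?A k) = {\<omega> \<in> space M. Z \<omega> \<le> K * c}"
  proof (intro equalityI subsetI)
    fix \<omega> assume "\<omega> \<in> (\<Inter>k. ?A k)"
    then show "\<omega> \<in> {\<omega> \<in> space M. Z \<omega> \<le> K * c}"
      using LIMSEQ_le_const[OF lim] by auto
  next
    fix \<omega> assume \<omega>: "\<omega> \<in> {\<omega> \<in> space M. Z \<omega> \<le> K * c}"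
    have "K * c \<le> (K + inverse (real (Suc k))) * c" for k
      using c by (intro mult_right_mono) auto
    then show "\<omega> \<in> (\<Inter>k. ?A k)"
      using \<omega> by (auto intro: order_trans)
  qed
  moreover have "p \<le> prob (?A k)" for k
    by (rule p) simp
  ultimately show ?thesis
    using LIMSEQ_le_const[of "\<lambda>k. prob (?A k)" _ p] by auto
qed

section \<open>Concentration of the sample mean under psi-norm bounds\<close>

lemma psi_norm_mono:
  assumes "\<And>\<omega>. \<omega> \<in> space M \<Longrightarrow> \<bar>X \<omega>\<bar> \<le> \<bar>Y \<omega>\<bar>"
  shows "psi_norm q M X \<le> psi_norm q M Y"
  unfolding psi_norm_def
proof (rule Inf_superset_mono, safe)
  fix t :: real assume t: "0 < t"
    and Y: "(\<integral>\<^sup>+ \<omega>. ennreal (exp (\<bar>Y \<omega>\<bar> ^ q / t ^ q)) \<partial>M) \<le> 2"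
  have "(\<integral>\<^sup>+ \<omega>. ennreal (exp (\<bar>X \<omega>\<bar> ^ q / t ^ q)) \<partial>M)
      \<le> (\<integral>\<^sup>+ \<omega>. ennreal (exp (\<bar>Y \<omega>\<bar> ^ q / t ^ q)) \<partial>M)"
    using t assms by (intro nn_integral_mono) (simp add: divide_right_mono power_mono)
  with t Y show "\<exists>t'. ennreal t = ennreal t' \<and> 0 < t'
      \<and> (\<integral>\<^sup>+ \<omega>. ennreal (exp (\<bar>X \<omega>\<bar> ^ q / t' ^ q)) \<partial>M) \<le> 2"
    using order_trans by blast
qed

text \<open>
  The infimum defining the norm is not known to be attained, but the set of admissible scales is
  closed upwards, so every scale strictly above the norm is admissible.
\<close>

lemma psi_norm_admissible:
  assumes K: "psi_norm q M X \<le> ennreal K" "0 \<le> K" "K < t"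
  shows "(\<integral>\<^sup>+ \<omega>. ennreal (exp (\<bar>X \<omega>\<bar> ^ q / t ^ q)) \<partial>M) \<le> 2"
proof -
  have "psi_norm q M X < ennreal t"
    using K by (simp add: order.strict_trans1 ennreal_less_iff)
  then obtain t' where t': "0 < t'" "t' < t"
      "(\<integral>\<^sup>+ \<omega>. ennreal (exp (\<bar>X \<omega>\<bar> ^ q / t' ^ q)) \<partial>M) \<le> 2"
    unfolding psi_norm_def Inf_less_iff by (auto simp: ennreal_less_iff)
  have "(\<integral>\<^sup>+ \<omega>. ennreal (exp (\<bar>X \<omega>\<bar> ^ q / t ^ q)) \<partial>M)
      \<le> (\<integral>\<^sup>+ \<omega>. ennreal (exp (\<bar>X \<omega>\<bar> ^ q / t' ^ q)) \<partial>M)"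
    using t' by (intro nn_integral_mono) (auto intro!: divide_left_mono power_mono)
  with t'(3) show ?thesis
    by (rule order_trans[rotated])
qed

lemma (in prob_space) integrable_of_psi_norm_1:
  assumes [measurable]: "X \<in> borel_measurable M" and "psi_norm 1 M X < \<infinity>"
  shows "integrable M X"
proof -
  obtain K where K: "psi_norm 1 M X = ennreal K" "0 \<le> K"
    using assms by (cases "psi_norm 1 M X") auto
  then have "(\<integral>\<^sup>+ \<omega>. ennreal (exp \<bar>X \<omega> / (K + 1)\<bar>) \<partial>M) \<le> ennreal 2"
    using psi_norm_admissible[of 1 M X K "K + 1"] by simp
  then have "integrable M (\<lambda>\<omega>. X \<omega> / (K + 1))"
    by (intro integrable_of_exp_abs[where B = 2]) auto
  then have "integrable M (\<lambda>\<omega>. (K + 1) * (X \<omega> / (K + 1)))"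
    by (rule integrable_mult_right)
  then show ?thesis
    using K by simp
qed

text \<open>
  The unconstrained minimiser of \<open>l\<^sup>2 - l * (2 * sqrt s)\<close> is \<open>l = sqrt s\<close>, but the moment
  generating function is only controlled for \<open>l \<le> 1\<close>. For \<open>s > 1\<close> the choice is
  \<open>l = 1\<close>, and the linear term \<open>s\<close> of the threshold then supplies the exponent.
\<close>

lemma (in prob_space) sample_mean_bernstein:
  fixes N :: nat and X :: "'a \<Rightarrow> real"
  assumes X[measurable]: "X \<in> borel_measurable M"
    and N: "0 < N" and K: "psi_norm 1 M X \<le> ennreal K" "0 \<le> K" and s: "0 < s"
  shows "1 - exp (- (real N * s))
      \<le> \<P>(\<omega> in Pi\<^sub>M {..<N} (\<lambda>_. M).
          (\<Sum>i<N. X (\<omega> i)) / real N - expectation X \<le> K * (2 * sqrt s + s))"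
proof -
  interpret PM: prob_space "Pi\<^sub>M {..<N} (\<lambda>_. M)"
    by (intro prob_space_PiM prob_space_axioms)
  show ?thesis
  proof (rule PM.prob_le_right_limit)
    fix t assume t: "K < t"
    then have t0: "0 < t"
      using K by simp
    define l where "l = min 1 (sqrt s)"
    have l: "0 < l" "l \<le> 1"
      using s by (auto simp: l_def)
    have "(\<integral>\<^sup>+\<omega>. ennreal (exp \<bar>X \<omega> / t\<bar>) \<partial>M) \<le> ennreal 2"
      using psi_norm_admissible[OF K t] t0 by simp
    then have "(\<integral>\<^sup>+\<omega>. ennreal (exp (l * (X \<omega> / t - expectation (\<lambda>\<omega>. X \<omega> / t)))) \<partial>M)
        \<le> ennreal (exp ((2 - 1) * l\<^sup>2))"
      using l by (intro centered_mgf_le) auto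
    then have mgf: "(\<integral>\<^sup>+\<omega>. ennreal (exp (l / t * (X \<omega> - expectation X))) \<partial>M) \<le> ennreal (exp (l\<^sup>2))"
      by (simp add: diff_divide_distrib[symmetric])
    have "l\<^sup>2 + s \<le> l * (2 * sqrt s + s)"
    proof (cases "s \<le> 1")
      case True
      then have "l = sqrt s"
        by (simp add: l_def min_def)
      then show ?thesis
        using s by (simp add: distrib_left mult.left_commute[of "sqrt s"])
    next
      case False
      then have "l = 1"
        by (simp add: l_def)
      moreover have "1 \<le> sqrt s"
        using False by simp
      then have "1 \<le> 2 * sqrt s"
        by linarith
      ultimately show ?thesis
        by simp
    qed
    then have b: "l\<^sup>2 + s \<le> l / t * (t * (2 * sqrt s + s))"
      using t0 by simp
    show "1 - exp (- (real N * s)) \<le> \<P>(\<omega> in Pi\<^sub>M {..<N} (\<lambda>_. M).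
          (\<Sum>i<N. X (\<omega> i)) / real N - expectation X \<le> t * (2 * sqrt s + s))"
      by (rule sample_mean_chernoff[OF X N _ mgf b]) (use l t0 in simp)
  qed (use s in \<open>auto intro: add_pos_pos\<close>)
qed

text \<open>
  Every \<open>l\<close> is allowed here, so \<open>l = sqrt s\<close> needs no truncation: the exponent
  \<open>3 * l\<^sup>2\<close> and the target \<open>s\<close> add up to \<open>l * (4 * sqrt s)\<close>.
\<close>

lemma (in prob_space) sample_mean_subgaussian:
  fixes N :: nat and X :: "'a \<Rightarrow> real"
  assumes X[measurable]: "X \<in> borel_measurable M"
    and N: "0 < N" and K: "psi_norm 2 M X \<le> ennreal K" "0 \<le> K" and s: "0 < s"
  shows "1 - exp (- (real N * s))
      \<le> \<P>(\<omega> in Pi\<^sub>M {..<N} (\<lambda>_. M).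
          (\<Sum>i<N. X (\<omega> i)) / real N - expectation X \<le> K * (4 * sqrt s))"
proof -
  interpret PM: prob_space "Pi\<^sub>M {..<N} (\<lambda>_. M)"
    by (intro prob_space_PiM prob_space_axioms)
  show ?thesis
  proof (rule PM.prob_le_right_limit)
    fix t assume t: "K < t"
    then have t0: "0 < t"
      using K by simp
    have "(\<integral>\<^sup>+\<omega>. ennreal (exp ((X \<omega> / t)\<^sup>2)) \<partial>M) \<le> ennreal 2"
      using psi_norm_admissible[OF K t] t0 by (simp add: power_divide)
    then have "(\<integral>\<^sup>+\<omega>. ennreal (exp (sqrt s * (X \<omega> / t - expectation (\<lambda>\<omega>. X \<omega> / t)))) \<partial>M)
        \<le> ennreal (exp (3 * (sqrt s)\<^sup>2))"
      using s by (intro centered_mgf_le_subgaussian) auto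
    then have mgf: "(\<integral>\<^sup>+\<omega>. ennreal (exp (sqrt s / t * (X \<omega> - expectation X))) \<partial>M)
        \<le> ennreal (exp (3 * s))"
      using s by (simp add: diff_divide_distrib[symmetric])
    have b: "3 * s + s \<le> sqrt s / t * (t * (4 * sqrt s))"
      using t0 s by simp
    show "1 - exp (- (real N * s)) \<le> \<P>(\<omega> in Pi\<^sub>M {..<N} (\<lambda>_. M).
          (\<Sum>i<N. X (\<omega> i)) / real N - expectation X \<le> t * (4 * sqrt s))"
      by (rule sample_mean_chernoff[OF X N _ mgf b]) (use s t0 in simp)
  qed (use s in auto)
qed

section \<open>Quadratic forms as inner products of vectorised matrices\<close>

text \<open>
  Reading \<open>svec\<close> as a weighted enumeration of one index list turns inner products of
  vectorised matrices into a single sum over that list.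
\<close>

definition upper_indices :: "nat \<Rightarrow> (nat \<times> nat) list" where
  "upper_indices n = map (\<lambda>i. (i, i)) [0..<n] @ [(i, j). i \<leftarrow> [0..<n], j \<leftarrow> [Suc i..<n]]"

lemma svec_eq_upper_indices:
  assumes "A \<in> carrier_mat n n"
  shows "svec A = vec_of_list
    (map (\<lambda>(i, j). (if i = j then 1 else sqrt 2) * A $$ (i, j)) (upper_indices n))"
proof -
  have "concat (map (\<lambda>i. map (\<lambda>j. (if i = j then 1 else sqrt 2) * A $$ (i, j)) [Suc i..<n]) [0..<n])
      = concat (map (\<lambda>i. map (\<lambda>j. sqrt 2 * A $$ (i, j)) [Suc i..<n]) [0..<n])"
    by (intro arg_cong[where f = concat] map_cong) auto
  then show ?thesis
    using assms by (simp add: svec_def upper_indices_def map_concat o_def)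
qed

lemma sum_symmetric_eq:
  fixes h :: "nat \<Rightarrow> nat \<Rightarrow> real"
  assumes "\<And>i j. i < n \<Longrightarrow> j < n \<Longrightarrow> h i j = h j i"
  shows "(\<Sum>i<n. \<Sum>j<n. h i j) = (\<Sum>i<n. h i i) + 2 * (\<Sum>i<n. \<Sum>j\<in>{Suc i..<n}. h i j)"
  using assms
proof (induction n)
  case (Suc n)
  have "(\<Sum>i<n. \<Sum>j\<in>{Suc i..<Suc n}. h i j) = (\<Sum>i<n. (\<Sum>j\<in>{Suc i..<n}. h i j) + h i n)"
    by (intro sum.cong) auto
  moreover have "(\<Sum>j<n. h n j) = (\<Sum>j<n. h j n)"
    by (intro sum.cong refl Suc.prems) simp_all
  moreover have "(\<Sum>i<n. \<Sum>j<n. h i j) = (\<Sum>i<n. h i i) + 2 * (\<Sum>i<n. \<Sum>j\<in>{Suc i..<n}. h i j)"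
    by (rule Suc.IH) (rule Suc.prems, simp_all)
  ultimately show ?case
    by (simp add: sum.distrib)
qed simp

text \<open>
  The factor \<open>sqrt 2\<close> is squared in the inner product, which restores the lower triangle:
  \<open>svec\<close> is an isometry for the Frobenius inner product.
\<close>

lemma svec_inner:
  assumes A: "A \<in> sym_mats n" and B: "B \<in> sym_mats n"
  shows "svec A \<bullet> svec B = (\<Sum>i<n. \<Sum>j<n. A $$ (i, j) * B $$ (i, j))"
proof -
  let ?w = "\<lambda>i j :: nat. (if i = j then 1 else sqrt 2)"
  let ?h = "\<lambda>(i, j). (?w i j * A $$ (i, j)) * (?w i j * B $$ (i, j))"
  have sym: "C $$ (i, j) = C $$ (j, i)" if "C \<in> sym_mats n" "i < n" "j < n" for C i j
    using that index_transpose_mat(1)[of i C j] by (auto simp: sym_mats_def)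
  have "svec A \<bullet> svec B = (\<Sum>k = 0..<length (upper_indices n). ?h (upper_indices n ! k))"
    using A B unfolding scalar_prod_def
    by (subst (1 2 3) svec_eq_upper_indices[where n = n])
      (auto simp: sym_mats_def vec_of_list_index split_beta intro!: sum.cong)
  also have "\<dots> = sum_list (map ?h (upper_indices n))"
    by (simp add: sum_list_sum_nth)
  also have "\<dots> = (\<Sum>i<n. ?h (i, i)) + (\<Sum>i<n. \<Sum>j\<in>{Suc i..<n}. ?h (i, j))"
  proof -
    have "sum_list (concat xss) = sum_list (map sum_list xss)" for xss :: "real list list"
      by (induction xss) auto
    then show ?thesis
      unfolding upper_indices_def
      by (simp only: map_append sum_list_append map_concat map_map o_def
          interv_sum_list_conv_sum_set_nat set_upt atLeast0LessThan)
  qed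
  also have "(\<Sum>i<n. ?h (i, i)) = (\<Sum>i<n. A $$ (i, i) * B $$ (i, i))"
    by simp
  also have "(\<Sum>i<n. \<Sum>j\<in>{Suc i..<n}. ?h (i, j))
      = 2 * (\<Sum>i<n. \<Sum>j\<in>{Suc i..<n}. A $$ (i, j) * B $$ (i, j))"
    by (auto simp: sum_distrib_left intro!: sum.cong)
  finally show ?thesis
    by (subst sum_symmetric_eq) (simp_all only: sym[OF A] sym[OF B])
qed

definition outer_square :: "real vec \<Rightarrow> real mat" where
  "outer_square y = mat (dim_vec y) (dim_vec y) (\<lambda>(i, j). y $ i * y $ j)"

definition quad_form :: "real vec \<Rightarrow> real mat \<Rightarrow> real" where
  "quad_form y A = y \<bullet> (A *\<^sub>v y)"

lemma outer_square_sym_mats: "y \<in> carrier_vec n \<Longrightarrow> outer_square y \<in> sym_mats n"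
  by (auto simp: sym_mats_def outer_square_def)

lemma quad_form_eq_sum:
  assumes "A \<in> carrier_mat n n" "y \<in> carrier_vec n"
  shows "quad_form y A = (\<Sum>i<n. \<Sum>j<n. y $ i * y $ j * A $$ (i, j))"
  using assms
  by (auto simp: quad_form_def scalar_prod_def atLeast0LessThan sum_distrib_left ac_simps intro!: sum.cong)

lemma quad_form_eq_svec_inner:
  assumes "A \<in> sym_mats n" "y \<in> carrier_vec n"
  shows "quad_form y A = svec (outer_square y) \<bullet> svec A"
proof -
  have "svec (outer_square y) \<bullet> svec A = (\<Sum>i<n. \<Sum>j<n. outer_square y $$ (i, j) * A $$ (i, j))"
    using assms by (intro svec_inner outer_square_sym_mats)
  also have "\<dots> = (\<Sum>i<n. \<Sum>j<n. y $ i * y $ j * A $$ (i, j))"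
    using assms by (intro sum.cong refl) (simp add: outer_square_def)
  also have "\<dots> = quad_form y A"
    using assms by (intro quad_form_eq_sum[symmetric]) (auto simp: sym_mats_def)
  finally show ?thesis ..
qed

text \<open>
  The squared Frobenius norm of \<open>y y\<^sup>T\<close> is the fourth power of the norm of \<open>y\<close>.
\<close>

lemma svec_outer_square_unit:
  assumes "y \<in> unit_sphere n"
  shows "svec (outer_square y) \<in> unit_sphere (n * (n + 1) div 2)"
proof -
  have y: "y \<in> carrier_vec n" "(\<Sum>i<n. y $ i * y $ i) = 1"
    using assms by (auto simp: unit_sphere_def vec_norm_def scalar_prod_def atLeast0LessThan)
  have "svec (outer_square y) \<bullet> svec (outer_square y)
      = (\<Sum>i<n. \<Sum>j<n. outer_square y $$ (i, j) * outer_square y $$ (i, j))"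
    by (intro svec_inner outer_square_sym_mats y)
  also have "\<dots> = (\<Sum>i<n. \<Sum>j<n. (y $ i * y $ i) * (y $ j * y $ j))"
    using y(1) by (intro sum.cong refl) (simp add: outer_square_def)
  also have "\<dots> = 1"
    using y(2) by (simp add: sum_product[symmetric])
  finally show ?thesis
    using outer_square_sym_mats[OF y(1)] dim_svec
    by (auto simp: unit_sphere_def vec_norm_def sym_mats_def intro!: carrier_vecI)
qed

lemma abs_scalar_prod_unit_le:
  assumes "u \<in> unit_sphere k" "v \<in> carrier_vec k"
  shows "\<bar>u \<bullet> v\<bar> \<le> vec_norm v"
proof -
  have "(u \<bullet> v)\<^sup>2 \<le> (u \<bullet> u) * (v \<bullet> v)"
    using assms Cauchy_Schwarz_ineq_sum[of "\<lambda>i. u $ i" "\<lambda>i. v $ i" "{0..<k}"]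
    by (auto simp: unit_sphere_def scalar_prod_def power2_eq_square)
  then show ?thesis
    using assms by (auto simp: unit_sphere_def vec_norm_def intro!: real_le_rsqrt)
qed

section \<open>The sampled matrices\<close>

context
  fixes P :: "real mat measure" and n :: nat
  assumes sets_P: "sets P = sets (sym_borel n)"
begin

lemma space_P: "space P = sym_mats n"
proof -
  have "space P = space (sym_borel n)"
    by (rule sets_eq_imp_space_eq[OF sets_P])
  then show ?thesis
    by (simp add: sym_borel_def space_measure_of_conv)
qed

lemma entry_measurable:
  assumes "i < n" "j < n"
  shows "(\<lambda>A. A $$ (i, j)) \<in> borel_measurable P"
proof -
  have "(\<lambda>A. A $$ (i, j)) \<in> borel_measurable (sym_borel n)"
  proof (rule measurableI)
    fix B :: "real set" assume "B \<in> sets borel"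
    then have "{A \<in> sym_mats n. A $$ (i, j) \<in> B} \<in> sets (sym_borel n)"
      unfolding sym_borel_def using assms
      by (subst sets_measure_of) auto
    moreover have "(\<lambda>A. A $$ (i, j)) -` B \<inter> space (sym_borel n) = {A \<in> sym_mats n. A $$ (i, j) \<in> B}"
      by (auto simp: sym_borel_def space_measure_of_conv)
    ultimately show "(\<lambda>A. A $$ (i, j)) -` B \<inter> space (sym_borel n) \<in> sets (sym_borel n)"
      by simp
  qed simp
  then show ?thesis
    by (simp add: measurable_cong_sets[OF sets_P refl])
qed

lemma quad_form_measurable:
  assumes "y \<in> carrier_vec n"
  shows "quad_form y \<in> borel_measurable P"
proof -
  have "(\<lambda>A. \<Sum>i<n. \<Sum>j<n. y $ i * y $ j * A $$ (i, j)) \<in> borel_measurable P"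
    using entry_measurable by (intro borel_measurable_sum borel_measurable_times) auto
  then show ?thesis
    using assms by (subst measurable_cong[where g = "\<lambda>A. \<Sum>i<n. \<Sum>j<n. y $ i * y $ j * A $$ (i, j)"])
      (auto simp: space_P sym_mats_def intro!: quad_form_eq_sum)
qed

text \<open>
  Polarisation: the off-diagonal entries are combinations of the quadratic forms at
  \<open>(e\<^sub>i + e\<^sub>j) / sqrt 2\<close>, \<open>e\<^sub>i\<close> and \<open>e\<^sub>j\<close>, so integrability in every unit
  direction suffices.
\<close>

lemma entry_integrable:
  assumes quad: "\<And>y. y \<in> unit_sphere n \<Longrightarrow> integrable P (quad_form y)"
    and i: "i < n" and j: "j < n"
  shows "integrable P (\<lambda>A. A $$ (i, j))"
proof -
  have diag: "integrable P (\<lambda>A. A $$ (k, k))" if "k < n" for k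
  proof -
    have u: "unit_vec n k \<in> unit_sphere n"
      using that by (simp add: unit_sphere_def vec_norm_def)
    have "quad_form (unit_vec n k) A = A $$ (k, k)" if "A \<in> space P" for A
    proof -
      have "A \<in> carrier_mat n n"
        using that by (simp add: space_P sym_mats_def)
      then show ?thesis
        using \<open>k < n\<close> by (simp add: quad_form_def)
    qed
    then show ?thesis
      using quad[OF u] by (rule Bochner_Integration.integrable_cong[THEN iffD1, OF refl])
  qed
  show ?thesis
  proof (cases "i = j")
    case True
    then show ?thesis
      using diag i by simp
  next
    case False
    define c where "c = 1 / sqrt 2"
    have c: "c * c = 1 / 2"
      by (simp add: c_def)
    define y where "y = c \<cdot>\<^sub>v (unit_vec n i + unit_vec n j)"
    have y: "y \<in> carrier_vec n"
      by (simp add: y_def)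
    have u: "y \<in> unit_sphere n"
      using False i j c
      by (simp add: y_def unit_sphere_def vec_norm_def scalar_prod_add_distrib[of _ n]
          add_scalar_prod_distrib[of _ n])
    have "2 * quad_form y A - A $$ (i, i) - A $$ (j, j) = 2 * A $$ (i, j)" if "A \<in> space P" for A
    proof -
      have A: "A \<in> carrier_mat n n" "A $$ (j, i) = A $$ (i, j)"
        using that i j index_transpose_mat(1)[of i A j] by (auto simp: space_P sym_mats_def)
      have "quad_form y A = c * c * (A $$ (i, i) + A $$ (i, j) + (A $$ (j, i) + A $$ (j, j)))"
        using A(1) i j
        by (simp add: y_def quad_form_def mult_mat_vec[of _ n n] mult_add_distrib_mat_vec[of _ n n]
          scalar_prod_add_distrib[of _ n] add_scalar_prod_distrib[of _ n] algebra_simps)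
      then show ?thesis
        using A c by simp
    qed
    moreover have "integrable P (\<lambda>A. 2 * quad_form y A - A $$ (i, i) - A $$ (j, j))"
      using quad[OF u] diag i j by simp
    ultimately have "integrable P (\<lambda>A. 2 * A $$ (i, j))"
      by (rule Bochner_Integration.integrable_cong[THEN iffD1, OF refl])
    then show ?thesis
      by simp
  qed
qed

text \<open>
  The mean matrix is defined entry by entry. Exchanging the expectation with the quadratic form
  requires each entry to be integrable; a non-integrable entry would have the integral \<open>0\<close> by
  convention.
\<close>

lemma quad_form_deviation:
  assumes quad: "\<And>y. y \<in> unit_sphere n \<Longrightarrow> integrable P (quad_form y)"
    and y: "y \<in> carrier_vec n" and Q: "Q \<in> space (sample_law N P)"
  shows "y \<bullet> ((empirical_mean n N Q - true_mean n P) *\<^sub>v y)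
    = (\<Sum>i<N. quad_form y (Q i)) / real N - (\<integral>A. quad_form y A \<partial>P)"
proof -
  have Qi: "Q i \<in> carrier_mat n n" if "i < N" for i
    using Q that by (auto simp: sample_law_def space_PiM space_P sym_mats_def PiE_iff)
  have "(\<integral>A. quad_form y A \<partial>P) = (\<integral>A. (\<Sum>i<n. \<Sum>j<n. y $ i * y $ j * A $$ (i, j)) \<partial>P)"
    using y by (intro Bochner_Integration.integral_cong)
      (auto simp: space_P sym_mats_def intro!: quad_form_eq_sum)
  also have "\<dots> = (\<Sum>i<n. \<Sum>j<n. y $ i * y $ j * (\<integral>A. A $$ (i, j) \<partial>P))"
    by (subst Bochner_Integration.integral_sum,
        intro Bochner_Integration.integrable_sum integrable_mult_right entry_integrable[OF quad])
      (auto intro!: sum.cong Bochner_Integration.integral_sum[THEN trans] entry_integrable[OF quad])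
  finally have mean: "(\<integral>A. quad_form y A \<partial>P) = (\<Sum>i<n. \<Sum>j<n. y $ i * y $ j * (\<integral>A. A $$ (i, j) \<partial>P))" .
  have "(\<Sum>k<N. quad_form y (Q k)) = (\<Sum>k<N. \<Sum>i<n. \<Sum>j<n. y $ i * y $ j * Q k $$ (i, j))"
    using Qi y by (intro sum.cong quad_form_eq_sum) auto
  also have "\<dots> = (\<Sum>i<n. \<Sum>j<n. y $ i * y $ j * (\<Sum>k<N. Q k $$ (i, j)))"
    by (simp only: sum_distrib_left sum.swap[of _ _ "{..<N}"])
  finally have emp: "(\<Sum>k<N. quad_form y (Q k)) / real N
      = (\<Sum>i<n. \<Sum>j<n. y $ i * y $ j * ((\<Sum>k<N. Q k $$ (i, j)) / real N))"
    by (simp add: sum_divide_distrib[where A = "{..<n}"])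
  have "y \<bullet> ((empirical_mean n N Q - true_mean n P) *\<^sub>v y)
      = (\<Sum>i<n. \<Sum>j<n. y $ i * y $ j * (empirical_mean n N Q - true_mean n P) $$ (i, j))"
    unfolding quad_form_def[symmetric]
    by (intro quad_form_eq_sum y minus_carrier_mat) (simp add: true_mean_def)
  also have "\<dots> = (\<Sum>i<n. \<Sum>j<n. y $ i * y $ j * ((\<Sum>k<N. Q k $$ (i, j)) / real N - (\<integral>A. A $$ (i, j) \<partial>P)))"
    by (intro sum.cong refl) (simp add: empirical_mean_def true_mean_def)
  also have "\<dots> = (\<Sum>k<N. quad_form y (Q k)) / real N - (\<integral>A. quad_form y A \<partial>P)"
    unfolding emp mean by (simp add: right_diff_distrib sum_subtractf)
  finally show ?thesis .
qed

end

lemma psi_norm_sample_component: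
  assumes "prob_space P" "i < N" and X: "X \<in> borel_measurable P"
  shows "psi_norm q (sample_law N P) (\<lambda>Q. X (Q i)) = psi_norm q P X"
proof -
  have comp: "P = distr (sample_law N P) P (\<lambda>Q. Q i)"
    unfolding sample_law_def using assms
    by (subst distr_PiM_component[where M = "\<lambda>_. P"]) auto
  have "(\<integral>\<^sup>+ A. ennreal (exp (\<bar>X A\<bar> ^ q / t ^ q)) \<partial>P)
      = (\<integral>\<^sup>+ Q. ennreal (exp (\<bar>X (Q i)\<bar> ^ q / t ^ q)) \<partial>sample_law N P)" for t
    using assms by (subst comp, subst nn_integral_distr) (auto simp: sample_law_def)
  then show ?thesis
    unfolding psi_norm_def by simp
qed

section \<open>Deviation bounds for the quadratic form\<close>

text \<open>
  The quadratic form is the marginal of \<open>svec\<close> in the direction \<open>svec (y y\<^sup>T)\<close>. As this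
  is a unit vector, the marginal is bounded by the supremum over directions, and by the norm of the
  vector itself.
\<close>

lemma psi_norm_quad_form_le:
  assumes P: "prob_space P" "sets P = sets (sym_borel n)"
    and y: "y \<in> unit_sphere n" and i: "i < N"
  shows "psi_norm q P (quad_form y) \<le> psi_norm_vec q (n * (n + 1) div 2) (sample_law N P) (\<lambda>Q. svec (Q i))"
    and "psi_norm q P (quad_form y) \<le> psi_norm q (sample_law N P) (\<lambda>Q. vec_norm (svec (Q i)))"
proof -
  let ?u = "svec (outer_square y)"
  have yc: "y \<in> carrier_vec n"
    using y by (simp add: unit_sphere_def)
  note u = svec_outer_square_unit[OF y]
  have Qi: "Q i \<in> sym_mats n" if "Q \<in> space (sample_law N P)" for Q
    using that i by (auto simp: sample_law_def space_PiM space_P[OF P(2)] PiE_iff)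
  have "psi_norm q P (quad_form y) = psi_norm q (sample_law N P) (\<lambda>Q. quad_form y (Q i))"
    using psi_norm_sample_component[OF P(1) i quad_form_measurable[OF P(2) yc]] by simp
  also have "\<dots> \<le> psi_norm q (sample_law N P) (\<lambda>Q. ?u \<bullet> svec (Q i))"
    by (intro psi_norm_mono) (simp add: quad_form_eq_svec_inner[OF Qi yc])
  finally have le: "psi_norm q P (quad_form y) \<le> psi_norm q (sample_law N P) (\<lambda>Q. ?u \<bullet> svec (Q i))" .
  also have "\<dots> \<le> psi_norm_vec q (n * (n + 1) div 2) (sample_law N P) (\<lambda>Q. svec (Q i))"
    unfolding psi_norm_vec_def by (intro SUP_upper u)
  finally show "psi_norm q P (quad_form y) \<le> psi_norm_vec q (n * (n + 1) div 2) (sample_law N P) (\<lambda>Q. svec (Q i))" .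
  note le
  also have "psi_norm q (sample_law N P) (\<lambda>Q. ?u \<bullet> svec (Q i))
      \<le> psi_norm q (sample_law N P) (\<lambda>Q. vec_norm (svec (Q i)))"
  proof (rule psi_norm_mono)
    fix Q assume "Q \<in> space (sample_law N P)"
    then have "svec (Q i) \<in> carrier_vec (n * (n + 1) div 2)"
      using Qi dim_svec by (auto simp: sym_mats_def intro!: carrier_vecI)
    then show "\<bar>?u \<bullet> svec (Q i)\<bar> \<le> \<bar>vec_norm (svec (Q i))\<bar>"
      using abs_scalar_prod_unit_le[OF u] order_trans[OF _ abs_ge_self] by blast
  qed
  finally show "psi_norm q P (quad_form y) \<le> psi_norm q (sample_law N P) (\<lambda>Q. vec_norm (svec (Q i)))" .
qed

theorem theorem4p15:
  shows "\<exists>C::real. C > 0 \<and>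
    (\<forall>(n::nat) (N::nat) (m::nat) (P::real mat measure) (\<beta>::real) (y::real vec).
      n \<ge> 1 \<longrightarrow> N \<ge> 1 \<longrightarrow> m = n * (n + 1) div 2 \<longrightarrow>
      prob_space P \<longrightarrow> sets P = sets (sym_borel n) \<longrightarrow>
      (\<forall>i<N. sub_exponential_vec m (sample_law N P) (\<lambda>Q. svec (Q i))) \<longrightarrow>
      0 < \<beta> \<longrightarrow> \<beta> < 1 \<longrightarrow> y \<in> unit_sphere n \<longrightarrow>
      (let K = enn2real (Max ((\<lambda>i. psi_norm_vec 1 m (sample_law N P) (\<lambda>Q. svec (Q i))) ` {..<N})) in
        \<P>(Q in sample_law N P.
          y \<bullet> ((empirical_mean n N Q - true_mean n P) *\<^sub>v y)
            \<le> C * K * (sqrt ((real m + ln (2 / \<beta>)) / real N) + (real m + ln (2 / \<beta>)) / real N))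
        \<ge> 1 - \<beta>) \<and>
      (\<forall>R::real. R > 0 \<longrightarrow>
        (\<forall>i<N. psi_norm 1 (sample_law N P) (\<lambda>Q. vec_norm (svec (Q i))) \<le> ennreal R) \<longrightarrow>
        \<P>(Q in sample_law N P.
          y \<bullet> ((empirical_mean n N Q - true_mean n P) *\<^sub>v y)
            \<le> 2 * sqrt 2 * R * sqrt (2 * ln (2 / \<beta>) / real N) + R * ln (2 / \<beta>) / real N)
        \<ge> 1 - \<beta>) \<and>
      ((\<forall>i<N. sub_gaussian_vec m (sample_law N P) (\<lambda>Q. svec (Q i))) \<longrightarrow>
        (let K = enn2real (Max ((\<lambda>i. psi_norm_vec 2 m (sample_law N P) (\<lambda>Q. svec (Q i))) ` {..<N})) in
          \<P>(Q in sample_law N P.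
            y \<bullet> ((empirical_mean n N Q - true_mean n P) *\<^sub>v y)
              \<le> C * K * (sqrt (real m / real N) + sqrt (ln (2 / \<beta>) / real N)))
          \<ge> 1 - \<beta>)))"
proof (rule exI[of _ 4], rule conjI[OF zero_less_numeral], intro allI impI, goal_cases)
  case (1 n N m P \<beta> y)
  then have N: "0 < N" and m: "m = n * (n + 1) div 2" and P: "prob_space P"
    and sets_P: "sets P = sets (sym_borel n)"
    and subexp: "\<forall>i<N. sub_exponential_vec m (sample_law N P) (\<lambda>Q. svec (Q i))"
    and \<beta>: "0 < \<beta>" "\<beta> < 1" and y: "y \<in> unit_sphere n"
    by auto
  interpret P: prob_space P by (rule P)
  interpret S: prob_space "sample_law N P"
    unfolding sample_law_def by (intro prob_space_PiM P)
  let ?dev = "\<lambda>Q. y \<bullet> ((empirical_mean n N Q - true_mean n P) *\<^sub>v y)"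
  let ?L = "ln (2 / \<beta>)"
  let ?psi = "\<lambda>q i. psi_norm_vec q m (sample_law N P) (\<lambda>Q. svec (Q i))"
  define s where "s = ?L / real N"
  have L: "0 < ?L"
    using \<beta> by (simp add: ln_div)
  then have s: "0 < s"
    using N by (simp add: s_def)
  have tail: "1 - \<beta> \<le> 1 - exp (- (real N * s))"
    using \<beta> N by (simp add: s_def exp_minus)
  have yc: "y \<in> carrier_vec n"
    using y by (simp add: unit_sphere_def)
  have X[measurable]: "quad_form y \<in> borel_measurable P"
    by (rule quad_form_measurable[OF sets_P yc])
  have integrable: "integrable P (quad_form z)" if z: "z \<in> unit_sphere n" for z
  proof (rule P.integrable_of_psi_norm_1)
    show "quad_form z \<in> borel_measurable P"
      using z by (intro quad_form_measurable[OF sets_P]) (simp add: unit_sphere_def)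
    show "psi_norm 1 P (quad_form z) < \<infinity>"
      using psi_norm_quad_form_le(1)[OF P sets_P z N, of 1] subexp N
      unfolding m sub_exponential_vec_def by (auto intro: order.strict_trans1)
  qed
  have weaken: "1 - \<beta> \<le> \<P>(Q in sample_law N P. ?dev Q \<le> b)"
    if bound: "1 - exp (- (real N * s)) \<le> \<P>(Q in Pi\<^sub>M {..<N} (\<lambda>_. P).
        (\<Sum>i<N. quad_form y (Q i)) / real N - P.expectation (quad_form y) \<le> a)"
      and ab: "a \<le> b" for a b
  proof -
    have sets[measurable]: "(\<lambda>Q. (\<Sum>i<N. quad_form y (Q i)) / real N - P.expectation (quad_form y))
        \<in> borel_measurable (sample_law N P)"
      unfolding sample_law_def by measurable
    have "1 - \<beta> \<le> \<P>(Q in sample_law N P.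
        (\<Sum>i<N. quad_form y (Q i)) / real N - P.expectation (quad_form y) \<le> a)"
      using order_trans[OF tail bound] by (simp add: sample_law_def)
    also have "\<dots> \<le> \<P>(Q in sample_law N P.
        (\<Sum>i<N. quad_form y (Q i)) / real N - P.expectation (quad_form y) \<le> b)"
      using ab by (intro S.finite_measure_mono) auto
    also have "\<dots> = \<P>(Q in sample_law N P. ?dev Q \<le> b)"
      using quad_form_deviation[OF sets_P integrable yc]
      by (intro arg_cong[where f = "measure _"] Collect_cong conj_cong refl) simp
    finally show ?thesis .
  qed
  \<comment> \<open>The components are identically distributed, so any of them, here the first, controls the
    scale; finiteness of the maximum makes the conversion to a real number faithful.\<close>
  have scale: "psi_norm q P (quad_form y) \<le> ennreal (enn2real (Max (?psi q ` {..<N})))"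
    if fin: "\<forall>i<N. ?psi q i < \<infinity>" for q
  proof -
    have "psi_norm q P (quad_form y) \<le> ?psi q 0"
      using psi_norm_quad_form_le(1)[OF P sets_P y N] by (simp add: m)
    also have "\<dots> \<le> Max (?psi q ` {..<N})"
      using N by (intro Max_ge) auto
    also have "\<dots> = ennreal (enn2real (Max (?psi q ` {..<N})))"
    proof -
      have "Max (?psi q ` {..<N}) < \<infinity>"
        using fin N by (subst Max_less_iff) auto
      then show ?thesis
        by simp
    qed
    finally show ?thesis .
  qed
  show ?case
    unfolding Let_def
  proof (intro conjI allI impI, goal_cases)
    case 1
    let ?K = "enn2real (Max (?psi 1 ` {..<N}))"
    define r where "r = (real m + ?L) / real N"
    have "s \<le> r"
      by (simp add: s_def r_def divide_right_mono)
    then have "2 * sqrt s \<le> 4 * sqrt r" "s \<le> 4 * r"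
      using s real_sqrt_le_mono[of s r] real_sqrt_ge_zero[OF less_imp_le[OF s]] by linarith+
    then have "2 * sqrt s + s \<le> 4 * (sqrt r + r)"
      by (simp add: distrib_left)
    then have "?K * (2 * sqrt s + s) \<le> ?K * (4 * (sqrt r + r))"
      by (rule mult_left_mono) simp
    then have "?K * (2 * sqrt s + s) \<le> 4 * ?K * (sqrt r + r)"
      by (simp only: mult.assoc mult.left_commute)
    then show ?case
      using subexp unfolding r_def
      by (intro weaken[OF P.sample_mean_bernstein[OF X N scale]] s)
        (simp_all add: sub_exponential_vec_def)
  next
    case (2 R)
    have "psi_norm 1 P (quad_form y) \<le> ennreal R"
      using psi_norm_quad_form_le(2)[OF P sets_P y N] 2 N order_trans by blast
    moreover have "R * (2 * sqrt s + s) \<le> 2 * sqrt 2 * R * sqrt (2 * ?L / real N) + R * ?L / real N"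
    proof -
      have "sqrt (2 * ?L / real N) = sqrt 2 * sqrt s"
        by (simp add: s_def real_sqrt_mult[symmetric])
      then have "2 * sqrt 2 * R * sqrt (2 * ?L / real N) + R * ?L / real N = R * (4 * sqrt s + s)"
        by (simp add: s_def algebra_simps)
      then show ?thesis
        using 2 s by simp
    qed
    ultimately show ?case
      using 2 by (intro weaken[OF P.sample_mean_bernstein[OF X N]] s) auto
  next
    case 3
    let ?K = "enn2real (Max (?psi 2 ` {..<N}))"
    have "?K * (4 * sqrt s) \<le> 4 * ?K * (sqrt (real m / real N) + sqrt (?L / real N))"
      by (simp add: s_def algebra_simps)
    then show ?case
      using 3 by (intro weaken[OF P.sample_mean_subgaussian[OF X N scale]] s)
        (auto simp: sub_gaussian_vec_def)
  qed
qed

end
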